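(* Let $(W,S)$ be a Coxeter system of type $\Lambda$, let $\alpha$ be a reduced expression of dimension at least one, and let $\{\alpha,\beta\}$ be an edge in $\mathcal{B}(\alpha)$. Then there exists a unique $i$ such that $\operatorname{sig}_i(\alpha)\neq\operatorname{sig}_i(\beta)$, and for this $i$ we have $W_{\alpha\beta}=\overline{\operatorname{sig}}_i(\alpha)$. Moreover, for every edge $\{x,y\}$ of $\mathcal{B}(\alpha)$, $\{x,y\}\in F_{\alpha\beta}$ if and only if $\{x,y\}$ is labeled by $i$.
   Context: A Coxeter system $(W,S)$ consists of a finite set $S$ and the group $W=\langle S\mid (st)^{m(s,t)}=e\rangle$, where $m(s,s)=1$ and $m(s,t)=m(t,s)\in\{2,3,\dots\}\cup\{\infty\}$ for $s\neq t$ ($m(s,t)=\infty$ means no relation). Its Coxeter graph has vertex set $S$ and an edge $\{s,t\}$ whenever $m(s,t)\ge 3$. $(W,S)$ is of type $\Lambda$ if $m(s,t)\le 3$ for all $s,t\in S$ (simply laced) and the Coxeter graph contains no three-cycles (triangle free). A reduced expression for $w\in W$ is a word over $S$ of minimal length representing $w$. A braid move replaces three consecutive letters $sts$ by $tst$, where $m(s,t)=3$. Two reduced expressions are braid equivalent if they are related by a finite sequence of braid moves; $[\alpha]$ denotes the braid class (equivalence class) of $\alpha$. The braid graph $\mathcal{B}(\alpha)$ has vertex set $[\alpha]$, with two vertices adjacent if and only if they are related by a single braid move; $d$ denotes its path metric. A braid shadow for a reduced expression $\alpha$ is a set of positions $\{i-1,i,i+1\}$ such that the letters of $\alpha$ in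 these positions form $sts$ with $m(s,t)=3$. $\mathcal{S}(\alpha)$ is the set of braid shadows for $\alpha$, and $\mathcal{S}([\alpha])=\bigcup_{\beta\in[\alpha]}\mathcal{S}(\beta)$. The center of a braid shadow $\{i-1,i,i+1\}\in\mathcal{S}([\alpha])$ is the position $i$. The dimension of $\alpha$ is $\dim(\alpha)=|\mathcal{S}([\alpha])|$, and the braid shadows in $\mathcal{S}([\alpha])$ are numbered $1,\dots,\dim(\alpha)$ from left to right. The signature $\operatorname{sig}(\alpha)$ is the ordered list whose $i$th entry $\operatorname{sig}_i(\alpha)$ is the letter of $\alpha$ in the center of the $i$th braid shadow of $[\alpha]$. Define $\overline{\operatorname{sig}}_i(\alpha)=\{x\in[\alpha]\mid\operatorname{sig}_i(x)=\operatorname{sig}_i(\alpha)\}$. An edge of $\mathcal{B}(\alpha)$ is labeled by $j$ if its endpoints are related by a single braid move performed in the $j$th braid shadow. For an edge $\{u,v\}$ of a graph, the semicube $W_{uv}$ is the set of vertices $w$ with $d(w,u)<d(w,v)$, and $F_{uv}$ is the set of edges $\{a,b\}$ having one endpoint in $W_{uv}$ and the other in $W_{vu}$. *)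

theory Defs
  imports "HOL-Algebra.Group" "HOL-Library.Extended_Nat"
begin

section \<open>Groups given by generators and relators\<close>

text \<open>
  A letter \<open>(s, True)\<close> stands for the generator \<open>s\<close>, and \<open>(s, False)\<close> for its formal inverse.
  The group presented by \<open>S\<close> and \<open>R\<close> consists of the signed words over \<open>S\<close> modulo the congruence
  generated by free cancellation and by \<open>r = e\<close> for \<open>r \<in> R\<close>.
\<close>

definition signed_words :: "'a set \<Rightarrow> ('a \<times> bool) list set" where
  "signed_words S = lists (S \<times> UNIV)"

inductive pres_eq :: "'a set \<Rightarrow> ('a \<times> bool) list set \<Rightarrow> ('a \<times> bool) list \<Rightarrow> ('a \<times> bool) list \<Rightarrow> bool"
  for S R where
  refl: "u \<in> signed_words S \<Longrightarrow> pres_eq S R u u"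
| sym: "pres_eq S R u v \<Longrightarrow> pres_eq S R v u"
| trans: "pres_eq S R u v \<Longrightarrow> pres_eq S R v w \<Longrightarrow> pres_eq S R u w"
| cancel: "u \<in> signed_words S \<Longrightarrow> v \<in> signed_words S \<Longrightarrow> s \<in> S \<Longrightarrow>
    pres_eq S R (u @ [(s, b), (s, \<not> b)] @ v) (u @ v)"
| relator: "u \<in> signed_words S \<Longrightarrow> v \<in> signed_words S \<Longrightarrow> r \<in> R \<Longrightarrow> r \<in> signed_words S \<Longrightarrow>
    pres_eq S R (u @ r @ v) (u @ v)"

definition pres_rel :: "'a set \<Rightarrow> ('a \<times> bool) list set \<Rightarrow> (('a \<times> bool) list \<times> ('a \<times> bool) list) set" where
  "pres_rel S R = {(u, v). pres_eq S R u v}"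

definition presented_group :: "'a set \<Rightarrow> ('a \<times> bool) list set \<Rightarrow> ('a \<times> bool) list set monoid" where
  "presented_group S R =
    \<lparr>carrier = signed_words S // pres_rel S R,
     mult = (\<lambda>A B. \<Union>a\<in>A. \<Union>b\<in>B. pres_rel S R `` {a @ b}),
     one = pres_rel S R `` {[]}\<rparr>"

lemma pres_eq_words:
  assumes "pres_eq S R u v"
  shows "u \<in> signed_words S \<and> v \<in> signed_words S"
  using assms by induction (auto simp: signed_words_def)

lemma pres_eq_context:
  assumes "pres_eq S R u v" "a \<in> signed_words S" "b \<in> signed_words S"
  shows "pres_eq S R (a @ u @ b) (a @ v @ b)"
  using assms
proof induction
  case (refl u)
  then show ?case by (intro pres_eq.refl) (auto simp: signed_words_def)
next
  case (sym u v)
  then show ?case by (blast intro: pres_eq.sym)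
next
  case (trans u v w)
  then show ?case by (blast intro: pres_eq.trans)
next
  case (cancel u v s c)
  then show ?case
    using pres_eq.cancel[of "a @ u" S "v @ b" s R c] by (auto simp: signed_words_def)
next
  case (relator u v r)
  then show ?case
    using pres_eq.relator[of "a @ u" S "v @ b" r R] by (auto simp: signed_words_def)
qed

lemma pres_eq_append:
  assumes "pres_eq S R u u'" "pres_eq S R v v'"
  shows "pres_eq S R (u @ v) (u' @ v')"
proof -
  have w: "u' \<in> signed_words S" "v \<in> signed_words S" "[] \<in> signed_words S"
    using pres_eq_words[OF assms(1)] pres_eq_words[OF assms(2)] by (auto simp: signed_words_def)
  show ?thesis
    using pres_eq_context[OF assms(1) w(3,2)] pres_eq_context[OF assms(2) w(1,3)]
    by (auto intro: pres_eq.trans)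
qed

lemma equiv_pres_rel: "equiv (signed_words S) (pres_rel S R)"
proof (rule equivI)
  show "pres_rel S R \<subseteq> signed_words S \<times> signed_words S"
    using pres_eq_words by (fastforce simp: pres_rel_def)
  show "refl_on (signed_words S) (pres_rel S R)"
    using pres_eq_words by (fastforce simp: refl_on_def pres_rel_def intro: pres_eq.refl)
  show "Relation.sym (pres_rel S R)"
    by (auto simp: Relation.sym_def pres_rel_def intro: pres_eq.sym)
  show "Relation.trans (pres_rel S R)"
    by (auto simp: Relation.trans_def pres_rel_def intro: pres_eq.trans)
qed

lemma presented_group_mult:
  assumes "u \<in> signed_words S" "v \<in> signed_words S"
  shows "pres_rel S R `` {u} \<otimes>\<^bsub>presented_group S R\<^esub> pres_rel S R `` {v} = pres_rel S R `` {u @ v}"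
proof -
  have "pres_rel S R `` {a @ b} = pres_rel S R `` {u @ v}"
    if "(u, a) \<in> pres_rel S R" "(v, b) \<in> pres_rel S R" for a b
    using that pres_eq_append[of S R u a v b] equiv_class_eq[OF equiv_pres_rel, of "u @ v" "a @ b" S R]
    by (simp add: pres_rel_def)
  moreover have "(u, u) \<in> pres_rel S R" "(v, v) \<in> pres_rel S R"
    using assms by (auto simp: pres_rel_def intro: pres_eq.refl)
  ultimately have "(\<Union>a\<in>pres_rel S R `` {u}. \<Union>b\<in>pres_rel S R `` {v}. pres_rel S R `` {a @ b}) =
      pres_rel S R `` {u @ v}"
    by blast
  then show ?thesis by (simp add: presented_group_def)
qed

lemma pres_eq_inverse:
  assumes "u \<in> signed_words S"
  shows "pres_eq S R (rev (map (\<lambda>(s, b). (s, \<not> b)) u) @ u) []"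
  using assms
proof (induction u)
  case Nil
  then show ?case by (auto intro: pres_eq.refl)
next
  case (Cons x u)
  obtain s b where x: "x = (s, b)" by fastforce
  define w where "w = rev (map (\<lambda>(s, b). (s, \<not> b)) u)"
  have "u \<in> signed_words S" "s \<in> S" "w \<in> signed_words S"
    using Cons.prems by (auto simp: signed_words_def x w_def in_lists_conv_set)
  then have "pres_eq S R (w @ [(s, \<not> b), (s, \<not> \<not> b)] @ u) (w @ u)"
    by (intro pres_eq.cancel)
  then show ?case
    using Cons.IH[OF \<open>u \<in> signed_words S\<close>] by (auto simp: x w_def intro: pres_eq.trans)
qed

lemma group_presented_group: "group (presented_group S R)"
proof (rule groupI)
  let ?G = "presented_group S R" and ?c = "\<lambda>u. pres_rel S R `` {u}"
  have car: "X \<in> carrier ?G \<longleftrightarrow> (\<exists>u\<in>signed_words S. X = ?c u)" for X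
    by (auto simp: presented_group_def quotient_def)
  have one: "\<one>\<^bsub>?G\<^esub> = ?c []" by (simp add: presented_group_def)
  have app: "u @ v \<in> signed_words S" if "u \<in> signed_words S" "v \<in> signed_words S" for u v :: "('a \<times> bool) list"
    using that by (auto simp: signed_words_def)
  have nil: "[] \<in> signed_words S" by (simp add: signed_words_def)
  show "x \<otimes>\<^bsub>?G\<^esub> y \<in> carrier ?G" if "x \<in> carrier ?G" "y \<in> carrier ?G" for x y
    using that app by (auto simp: car presented_group_mult)
  show "\<one>\<^bsub>?G\<^esub> \<in> carrier ?G" using nil by (auto simp: car one)
  show "x \<otimes>\<^bsub>?G\<^esub> y \<otimes>\<^bsub>?G\<^esub> z = x \<otimes>\<^bsub>?G\<^esub> (y \<otimes>\<^bsub>?G\<^esub> z)"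
    if "x \<in> carrier ?G" "y \<in> carrier ?G" "z \<in> carrier ?G" for x y z
    using that app by (auto simp: car presented_group_mult)
  show "\<one>\<^bsub>?G\<^esub> \<otimes>\<^bsub>?G\<^esub> x = x" if "x \<in> carrier ?G" for x
    using that nil by (auto simp: car one presented_group_mult)
  show "\<exists>y\<in>carrier ?G. y \<otimes>\<^bsub>?G\<^esub> x = \<one>\<^bsub>?G\<^esub>" if x: "x \<in> carrier ?G" for x
  proof -
    obtain u where u: "u \<in> signed_words S" "x = ?c u" using x by (auto simp: car)
    let ?w = "rev (map (\<lambda>(s, b). (s, \<not> b)) u)"
    have w: "?w \<in> signed_words S"
      using u by (auto simp: signed_words_def in_lists_conv_set)
    have "(?w @ u, []) \<in> pres_rel S R"
      using pres_eq_inverse[OF u(1)] by (simp add: pres_rel_def)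
    then have "?c (?w @ u) = ?c []" by (rule equiv_class_eq[OF equiv_pres_rel])
    then show ?thesis
      using w u by (intro bexI[of _ "?c ?w"]) (auto simp: car one presented_group_mult)
  qed
qed


section \<open>Coxeter systems\<close>

definition coxeter_matrix :: "'a set \<Rightarrow> ('a \<Rightarrow> 'a \<Rightarrow> enat) \<Rightarrow> bool" where
  "coxeter_matrix S m \<longleftrightarrow>
     finite S \<and>
     (\<forall>s\<in>S. m s s = 1) \<and>
     (\<forall>s\<in>S. \<forall>t\<in>S. m s t = m t s) \<and>
     (\<forall>s\<in>S. \<forall>t\<in>S. s \<noteq> t \<longrightarrow> 2 \<le> m s t)"

definition coxeter_relators :: "'a set \<Rightarrow> ('a \<Rightarrow> 'a \<Rightarrow> enat) \<Rightarrow> ('a \<times> bool) list set" where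
  "coxeter_relators S m =
     {concat (replicate k [(s, True), (t, True)]) | s t k. s \<in> S \<and> t \<in> S \<and> m s t = enat k}"

definition coxeter_group :: "'a set \<Rightarrow> ('a \<Rightarrow> 'a \<Rightarrow> enat) \<Rightarrow> ('a \<times> bool) list set monoid" where
  "coxeter_group S m = presented_group S (coxeter_relators S m)"

definition coxeter_gen :: "'a set \<Rightarrow> ('a \<Rightarrow> 'a \<Rightarrow> enat) \<Rightarrow> 'a \<Rightarrow> ('a \<times> bool) list set" where
  "coxeter_gen S m s = pres_rel S (coxeter_relators S m) `` {[(s, True)]}"

definition word_value :: "'a set \<Rightarrow> ('a \<Rightarrow> 'a \<Rightarrow> enat) \<Rightarrow> 'a list \<Rightarrow> ('a \<times> bool) list set" where
  "word_value S m \<alpha> =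
     foldr (\<lambda>s g. coxeter_gen S m s \<otimes>\<^bsub>coxeter_group S m\<^esub> g) \<alpha> \<one>\<^bsub>coxeter_group S m\<^esub>"

definition reduced_expr :: "'a set \<Rightarrow> ('a \<Rightarrow> 'a \<Rightarrow> enat) \<Rightarrow> 'a list \<Rightarrow> bool" where
  "reduced_expr S m \<alpha> \<longleftrightarrow>
     \<alpha> \<in> lists S \<and>
     (\<forall>\<beta>\<in>lists S. word_value S m \<beta> = word_value S m \<alpha> \<longrightarrow> length \<alpha> \<le> length \<beta>)"


section \<open>Graphs\<close>

record 'v graph =
  vertices :: "'v set"
  edges :: "'v set set"

definition triangle_free :: "'v graph \<Rightarrow> bool" where
  "triangle_free G \<longleftrightarrow>
     \<not> (\<exists>a b c. distinct [a, b, c] \<and> {a, b} \<in> edges G \<and> {b, c} \<in> edges G \<and> {a, c} \<in> edges G)"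

definition walk :: "'v graph \<Rightarrow> 'v \<Rightarrow> 'v list \<Rightarrow> 'v \<Rightarrow> bool" where
  "walk G u p v \<longleftrightarrow>
     p \<noteq> [] \<and> hd p = u \<and> last p = v \<and> set p \<subseteq> vertices G \<and>
     successively (\<lambda>a b. {a, b} \<in> edges G) p"

text \<open>A walk visiting \<open>n + 1\<close> vertices has length \<open>n\<close>; vertices without a connecting walk have
  distance \<open>\<infinity>\<close>.\<close>

definition graph_dist :: "'v graph \<Rightarrow> 'v \<Rightarrow> 'v \<Rightarrow> enat" where
  "graph_dist G u v = (INF p\<in>{p. walk G u p v}. enat (length p - 1))"

definition semicube :: "'v graph \<Rightarrow> 'v \<Rightarrow> 'v \<Rightarrow> 'v set" where
  "semicube G u v = {w \<in> vertices G. graph_dist G w u < graph_dist G w v}"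

definition cut_edges :: "'v graph \<Rightarrow> 'v \<Rightarrow> 'v \<Rightarrow> 'v set set" where
  "cut_edges G u v =
     {e \<in> edges G. \<exists>a b. e = {a, b} \<and> a \<in> semicube G u v \<and> b \<in> semicube G v u}"

definition coxeter_graph :: "'a set \<Rightarrow> ('a \<Rightarrow> 'a \<Rightarrow> enat) \<Rightarrow> 'a graph" where
  "coxeter_graph S m =
     \<lparr>vertices = S, edges = {{s, t} | s t. s \<in> S \<and> t \<in> S \<and> 3 \<le> m s t}\<rparr>"

definition type_Lambda :: "'a set \<Rightarrow> ('a \<Rightarrow> 'a \<Rightarrow> enat) \<Rightarrow> bool" where
  "type_Lambda S m \<longleftrightarrow>
     (\<forall>s\<in>S. \<forall>t\<in>S. m s t \<le> 3) \<and> triangle_free (coxeter_graph S m)"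


section \<open>Braid classes and braid graphs\<close>

text \<open>Positions in a word are list indices and so start at \<open>0\<close>.
  In \<open>braid_move_at S m i\<close> the move takes place in the positions \<open>i - 1, i, i + 1\<close>.\<close>

definition braid_move_at :: "'a set \<Rightarrow> ('a \<Rightarrow> 'a \<Rightarrow> enat) \<Rightarrow> nat \<Rightarrow> 'a list \<Rightarrow> 'a list \<Rightarrow> bool" where
  "braid_move_at S m i \<alpha> \<beta> \<longleftrightarrow>
     (\<exists>u v s t. s \<in> S \<and> t \<in> S \<and> m s t = 3 \<and> i = length u + 1 \<and>
        \<alpha> = u @ [s, t, s] @ v \<and> \<beta> = u @ [t, s, t] @ v)"

definition braid_move :: "'a set \<Rightarrow> ('a \<Rightarrow> 'a \<Rightarrow> enat) \<Rightarrow> 'a list \<Rightarrow> 'a list \<Rightarrow> bool" where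
  "braid_move S m \<alpha> \<beta> \<longleftrightarrow> (\<exists>i. braid_move_at S m i \<alpha> \<beta>)"

definition braid_class :: "'a set \<Rightarrow> ('a \<Rightarrow> 'a \<Rightarrow> enat) \<Rightarrow> 'a list \<Rightarrow> 'a list set" where
  "braid_class S m \<alpha> = {\<beta>. reduced_expr S m \<beta> \<and> (braid_move S m)\<^sup>*\<^sup>* \<alpha> \<beta>}"

definition braid_graph :: "'a set \<Rightarrow> ('a \<Rightarrow> 'a \<Rightarrow> enat) \<Rightarrow> 'a list \<Rightarrow> 'a list graph" where
  "braid_graph S m \<alpha> =
     \<lparr>vertices = braid_class S m \<alpha>,
      edges = {{x, y} | x y. x \<in> braid_class S m \<alpha> \<and> y \<in> braid_class S m \<alpha> \<and> braid_move S m x y}\<rparr>"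

definition braid_shadows :: "'a set \<Rightarrow> ('a \<Rightarrow> 'a \<Rightarrow> enat) \<Rightarrow> 'a list \<Rightarrow> nat set set" where
  "braid_shadows S m \<alpha> =
     {{i - 1, i, i + 1} | i s t. 1 \<le> i \<and> i + 1 < length \<alpha> \<and> s \<in> S \<and> t \<in> S \<and> m s t = 3 \<and>
        \<alpha> ! (i - 1) = s \<and> \<alpha> ! i = t \<and> \<alpha> ! (i + 1) = s}"

definition class_shadows :: "'a set \<Rightarrow> ('a \<Rightarrow> 'a \<Rightarrow> enat) \<Rightarrow> 'a list \<Rightarrow> nat set set" where
  "class_shadows S m \<alpha> = (\<Union>\<beta>\<in>braid_class S m \<alpha>. braid_shadows S m \<beta>)"

definition shadow_center :: "nat set \<Rightarrow> nat" where
  "shadow_center A = (THE i. 1 \<le> i \<and> A = {i - 1, i, i + 1})"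

definition braid_dim :: "'a set \<Rightarrow> ('a \<Rightarrow> 'a \<Rightarrow> enat) \<Rightarrow> 'a list \<Rightarrow> nat" where
  "braid_dim S m \<alpha> = card (class_shadows S m \<alpha>)"

text \<open>Ordering the shadows of a class from left to right means ordering their centers.\<close>

definition class_centers :: "'a set \<Rightarrow> ('a \<Rightarrow> 'a \<Rightarrow> enat) \<Rightarrow> 'a list \<Rightarrow> nat list" where
  "class_centers S m \<alpha> = sorted_list_of_set (shadow_center ` class_shadows S m \<alpha>)"

definition signature :: "'a set \<Rightarrow> ('a \<Rightarrow> 'a \<Rightarrow> enat) \<Rightarrow> 'a list \<Rightarrow> 'a list" where
  "signature S m \<alpha> = map (\<lambda>i. \<alpha> ! i) (class_centers S m \<alpha>)"

text \<open>The shadows of a class are numbered \<open>1, \<dots>, dim\<close>, hence the index shifts by one below;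
  these are meaningful only for \<open>j\<close> in this range.\<close>

definition sig_entry :: "'a set \<Rightarrow> ('a \<Rightarrow> 'a \<Rightarrow> enat) \<Rightarrow> nat \<Rightarrow> 'a list \<Rightarrow> 'a" where
  "sig_entry S m j \<alpha> = signature S m \<alpha> ! (j - 1)"

definition sig_fiber :: "'a set \<Rightarrow> ('a \<Rightarrow> 'a \<Rightarrow> enat) \<Rightarrow> nat \<Rightarrow> 'a list \<Rightarrow> 'a list set" where
  "sig_fiber S m j \<alpha> = {x \<in> braid_class S m \<alpha>. sig_entry S m j x = sig_entry S m j \<alpha>}"

definition edge_labeled :: "'a set \<Rightarrow> ('a \<Rightarrow> 'a \<Rightarrow> enat) \<Rightarrow> 'a list \<Rightarrow> 'a list set \<Rightarrow> nat \<Rightarrow> bool" where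
  "edge_labeled S m \<alpha> e j \<longleftrightarrow>
     e \<in> edges (braid_graph S m \<alpha>) \<and> j \<in> {1..braid_dim S m \<alpha>} \<and>
     (\<exists>x y. e = {x, y} \<and> braid_move_at S m (class_centers S m \<alpha> ! (j - 1)) x y)"

end

theory Submission
  imports Defs
begin

text \<open>
  The proposition reduces to one fact: the distance between two words in the braid graph is the
  number of centers at which they carry different letters, that is, the Hamming distance of
  their signatures. Granting this, a braid move at center \<open>c\<close> changes the signature in the entry
  of \<open>c\<close> only, so \<open>\<alpha>\<close> and \<open>\<beta>\<close> differ in one entry and a word \<open>w\<close> is closer to \<open>\<alpha>\<close> than to \<open>\<beta>\<close>
  exactly if it agrees with \<open>\<alpha>\<close> there (\<open>hamming_flip\<close>). An edge crosses the cut exactly if it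
  changes the letter at \<open>c\<close> from \<open>\<alpha> ! c\<close> to \<open>\<beta> ! c\<close> or back; since the unordered pair of letters
  exchanged at a center is the same throughout the class, these are the edges whose move is at
  \<open>c\<close>.

  A braid move is determined by its center, so a path in the braid graph is a list of centers.
  Every path changes at most one signature entry per step, which bounds the distance from below.
  For the bound from above it is enough that a shortest path never uses a center twice: then
  every move on it changes the letter at its center for good. This is \<open>repetition_shortens\<close>, and
  it rests on two rigidity properties of a braid class, each proved by taking a shortest path
  that violates it.

  \<^item> No two centers are adjacent (\<open>centers_not_adjacent_path\<close>). If a shortest path led from a
    word with shadow at \<open>c\<close> to a word with shadow at \<open>c + 1\<close>, its moves would stay away from the
    positions \<open>c\<close> and \<open>c + 1\<close>, and so split into moves on the left and moves on the right that
    do not interact. Performing only those on the right yields a word with a factor \<open>stst\<close>,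
    which is not reduced.

  \<^item> All shadows at a given center show the same unordered pair of letters (\<open>shadow_pair_path\<close>).
    If a shortest path led from \<open>sts\<close> to \<open>utu\<close> at the same center, the left letter would change
    from \<open>s\<close> to \<open>u\<close> by moves at one center, two positions to the left, which by minimality
    exchange one pair. Hence this pair is \<open>{s, u}\<close>, and \<open>s\<close>, \<open>t\<close>, \<open>u\<close> form a triangle of the
    Coxeter graph.

  Suppose now that a path uses \<open>c\<close> twice, with distinct centers different from \<open>c\<close> in between.
  The pair of letters at \<open>c\<close> and the center letter are the same before and after the
  intermediate moves, hence so are the two outer letters of the shadow. A single move at \<open>c - 2\<close>
  or \<open>c + 2\<close> would change one of them, so the intermediate moves do not touch the shadow at all,
  and both moves at \<open>c\<close> can be left out.
\<close>

section \<open>Braid moves as flips at a center\<close>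

text \<open>
  Defined on every word, so that a path of moves is a list of positions and \<open>fold flip\<close> gives
  its endpoint. On a word \<open>\<dots>sts\<dots>\<close> with center \<open>c\<close> it is the braid move.
\<close>

definition flip :: "nat \<Rightarrow> 'a list \<Rightarrow> 'a list" where
  "flip c x = x[c - 1 := x ! c, c := x ! (c - 1), c + 1 := x ! c]"

definition active :: "('a \<Rightarrow> 'a \<Rightarrow> bool) \<Rightarrow> nat \<Rightarrow> 'a list \<Rightarrow> bool" where
  "active M c x \<longleftrightarrow> 1 \<le> c \<and> c + 1 < length x \<and> x ! (c - 1) = x ! (c + 1) \<and> M (x ! (c - 1)) (x ! c)"

fun braid_path :: "('a \<Rightarrow> 'a \<Rightarrow> bool) \<Rightarrow> 'a list \<Rightarrow> nat list \<Rightarrow> bool" where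
  "braid_path M x [] = True"
| "braid_path M x (c # cs) = (active M c x \<and> braid_path M (flip c x) cs)"

lemma activeD:
  assumes "active M c x"
  shows "1 \<le> c" "c + 1 < length x" "x ! (c - 1) = x ! (c + 1)" "M (x ! (c - 1)) (x ! c)"
  using assms unfolding active_def by blast+

lemma length_flip [simp]: "length (flip c x) = length x"
  by (simp add: flip_def)

lemma length_fold_flip [simp]: "length (fold flip cs x) = length x"
  by (induction cs arbitrary: x) auto

lemma flip_nth:
  assumes "active M c x"
  shows "flip c x ! k = (if k = c then x ! (c - 1) else if k = c - 1 \<or> k = c + 1 then x ! c else x ! k)"
  using assms by (auto simp: flip_def active_def nth_list_update)

lemma braid_path_append [simp]:
  "braid_path M x (cs @ ds) \<longleftrightarrow> braid_path M x cs \<and> braid_path M (fold flip cs x) ds"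
  by (induction cs arbitrary: x) auto

lemma fold_flip_untouched:
  assumes "braid_path M x cs" "\<And>e. e \<in> set cs \<Longrightarrow> k \<notin> {e - 1, e, e + 1}"
  shows "fold flip cs x ! k = x ! k"
  using assms by (induction cs arbitrary: x) (auto simp: flip_nth)

text \<open>
  Moves whose shadows lie inside \<open>P\<close> do not interact with moves whose shadows avoid \<open>P\<close>, so the
  former can be performed alone, starting from any word that agrees with the original one on
  \<open>P\<close>.
\<close>

lemma braid_path_restrict:
  assumes "braid_path M x cs" "length x' = length x" "\<And>k. k \<in> P \<Longrightarrow> x' ! k = x ! k"
    and "\<And>e. e \<in> set cs \<Longrightarrow> {e - 1, e, e + 1} \<subseteq> P \<or> {e - 1, e, e + 1} \<inter> P = {}"
  shows "braid_path M x' (filter (\<lambda>e. e \<in> P) cs)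
    \<and> (\<forall>k. fold flip (filter (\<lambda>e. e \<in> P) cs) x' ! k = (if k \<in> P then fold flip cs x ! k else x' ! k))"
  using assms
proof (induction cs arbitrary: x x')
  case Nil
  then show ?case by simp
next
  case (Cons c cs)
  have act: "active M c x" and path: "braid_path M (flip c x) cs"
    using Cons.prems(1) by auto
  show ?case
  proof (cases "c \<in> P")
    case True
    then have sub: "{c - 1, c, c + 1} \<subseteq> P"
      using Cons.prems(4)[of c] by auto
    then have eqs: "x' ! (c - 1) = x ! (c - 1)" "x' ! c = x ! c" "x' ! (c + 1) = x ! (c + 1)"
      using Cons.prems(3) by blast+
    have act': "active M c x'"
      using act unfolding active_def eqs Cons.prems(2) .
    have "flip c x' ! k = flip c x ! k" if "k \<in> P" for k
      using that eqs Cons.prems(3) by (simp add: flip_nth[OF act] flip_nth[OF act'])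
    then have IH: "braid_path M (flip c x') (filter (\<lambda>e. e \<in> P) cs)
      \<and> (\<forall>k. fold flip (filter (\<lambda>e. e \<in> P) cs) (flip c x') ! k
            = (if k \<in> P then fold flip cs (flip c x) ! k else flip c x' ! k))"
      using Cons.prems(2,4) by (intro Cons.IH[OF path]) auto
    have "flip c x' ! k = x' ! k" if "k \<notin> P" for k
      using that sub by (auto simp: flip_nth[OF act'])
    then show ?thesis using True IH act' by simp
  next
    case False
    then have dis: "{c - 1, c, c + 1} \<inter> P = {}"
      using Cons.prems(4)[of c] by auto
    then have "x' ! k = flip c x ! k" if "k \<in> P" for k
      using that Cons.prems(3) by (auto simp: flip_nth[OF act])
    then show ?thesis
      using False Cons.IH[OF path, of x'] Cons.prems(2,4) by simp
  qed
qed

lemma active_letter_changes: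
  assumes "active M c x" "\<And>a. \<not> M a a" "k \<in> {c - 1, c, c + 1}"
  shows "flip c x ! k \<noteq> x ! k"
proof -
  have "x ! (c - 1) \<noteq> x ! c" "x ! (c + 1) \<noteq> x ! c"
    using assms(1,2) unfolding active_def by metis+
  then show ?thesis using assms(3) by (auto simp: flip_nth[OF assms(1)] simp del: One_nat_def)
qed

lemma once_touched_letter_changes:
  assumes "braid_path M x cs" "\<And>a. \<not> M a a" "distinct cs" "c \<in> set cs" "k \<in> {c - 1, c, c + 1}"
    and "\<And>e. e \<in> set cs \<Longrightarrow> e \<noteq> c \<Longrightarrow> k \<notin> {e - 1, e, e + 1}"
  shows "fold flip cs x ! k \<noteq> x ! k"
proof -
  obtain as bs where cs: "cs = as @ c # bs" using split_list[OF assms(4)] by blast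
  let ?y = "fold flip as x"
  have p: "braid_path M x as" "active M c ?y" "braid_path M (flip c ?y) bs"
    using assms(1) by (auto simp: cs)
  have "fold flip bs (flip c ?y) ! k = flip c ?y ! k"
    using assms(3,6) by (intro fold_flip_untouched[OF p(3)]) (auto simp: cs)
  moreover have "?y ! k = x ! k"
    using assms(3,6) by (intro fold_flip_untouched[OF p(1)]) (auto simp: cs)
  moreover have "flip c ?y ! k \<noteq> ?y ! k"
    using active_letter_changes[OF p(2) assms(2,5)] .
  ultimately show ?thesis by (simp add: cs)
qed

lemma innermost_repetition:
  "\<not> distinct cs \<Longrightarrow> \<exists>as c bs ds. cs = as @ c # bs @ c # ds \<and> distinct bs \<and> c \<notin> set bs"
proof (induction cs)
  case Nil
  then show ?case by simp
next
  case (Cons e cs)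
  show ?case
  proof (cases "distinct cs")
    case True
    then have "e \<in> set cs" using Cons.prems by simp
    then obtain bs ds where cs: "cs = bs @ e # ds" "e \<notin> set bs" by (blast dest: split_list_first)
    then have "e # cs = [] @ e # bs @ e # ds \<and> distinct bs \<and> e \<notin> set bs" using True by simp
    then show ?thesis by blast
  next
    case False
    then obtain as c bs ds where "cs = as @ c # bs @ c # ds" "distinct bs" "c \<notin> set bs"
      using Cons.IH by blast
    then have "e # cs = (e # as) @ c # bs @ c # ds \<and> distinct bs \<and> c \<notin> set bs" by simp
    then show ?thesis by blast
  qed
qed

section \<open>Rigidity of braid classes\<close>

text \<open>
  The properties of a braid class from which the geometry of its braid graph follows. Here
  \<open>M s t\<close> stands for \<open>m s t = 3\<close>, and \<open>no_alternating_four\<close> excludes factors \<open>stst\<close>: this is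
  what reducedness contributes. Moves are reversible, so paths from a single word \<open>a\<close> connect
  all words.
\<close>

locale braid_words =
  fixes M :: "'a \<Rightarrow> 'a \<Rightarrow> bool" and K :: "'a list set"
  assumes M_sym: "M a b \<Longrightarrow> M b a"
    and M_irrefl: "\<not> M a a"
    and M_triangle_free: "M a b \<Longrightarrow> M b d \<Longrightarrow> \<not> M a d"
    and flip_closed: "x \<in> K \<Longrightarrow> active M c x \<Longrightarrow> flip c x \<in> K"
    and no_alternating_four: "x \<in> K \<Longrightarrow> active M c x \<Longrightarrow> c + 2 < length x \<Longrightarrow> x ! (c + 2) \<noteq> x ! c"
    and rooted: "\<exists>a\<in>K. \<forall>x\<in>K. \<exists>cs. braid_path M a cs \<and> fold flip cs a = x"
begin

lemma active_flip:
  assumes "active M c x" shows "active M c (flip c x)"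
proof -
  have "flip c x ! (c - 1) = x ! c" "flip c x ! c = x ! (c - 1)" "flip c x ! (c + 1) = x ! c"
    using assms by (simp_all only: flip_nth[OF assms]) (simp_all add: active_def)
  then show ?thesis using assms M_sym unfolding active_def length_flip by metis
qed

lemma flip_flip:
  assumes "active M c x" shows "flip c (flip c x) = x"
proof (rule nth_equalityI)
  fix k
  have "c - 1 \<noteq> c" "x ! (c - 1) = x ! (c + 1)" using assms by (auto simp: active_def)
  then show "flip c (flip c x) ! k = x ! k"
    unfolding flip_nth[OF active_flip[OF assms]] flip_nth[OF assms] by (smt (verit))
qed simp

lemma braid_path_rev:
  "braid_path M x cs \<Longrightarrow> braid_path M (fold flip cs x) (rev cs) \<and> fold flip (rev cs) (fold flip cs x) = x"
  by (induction cs arbitrary: x) (auto simp: active_flip flip_flip)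

lemma fold_flip_closed: "x \<in> K \<Longrightarrow> braid_path M x cs \<Longrightarrow> fold flip cs x \<in> K"
  by (induction cs arbitrary: x) (auto simp: flip_closed)

lemma connected:
  assumes "x \<in> K" "y \<in> K"
  shows "\<exists>cs. braid_path M x cs \<and> fold flip cs x = y"
proof -
  obtain a cs ds where "braid_path M a cs" "fold flip cs a = x" "braid_path M a ds" "fold flip ds a = y"
    using rooted assms by metis
  then have "braid_path M x (rev cs @ ds)" "fold flip (rev cs @ ds) x = y"
    using braid_path_rev[of a cs] by auto
  then show ?thesis by blast
qed

text \<open>
  Strong induction on the length of the path plays the role of a shortest counterexample. For
  \<open>c' = c + 1\<close>, by the induction hypothesis no move takes place at \<open>c - 1\<close>, \<open>c\<close>, \<open>c + 1\<close> or
  \<open>c + 2\<close>. The moves to the right of \<open>c + 2\<close> alone then produce the letter \<open>x ! c\<close> at position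
  \<open>c + 2\<close> while the shadow at \<open>c\<close> stays in place.
\<close>

lemma centers_not_adjacent_path:
  assumes "x \<in> K" "braid_path M x cs" "active M c x" "active M c' (fold flip cs x)"
  shows "c' \<noteq> Suc c \<and> c \<noteq> Suc c'"
  using assms
proof (induction "length cs" arbitrary: x cs c c' rule: less_induct)
  case less
  \<comment> \<open>The case \<open>c' = c + 1\<close>, stated for an arbitrary path so that it also applies to the reversed
    one, which settles the case \<open>c = c' + 1\<close>.\<close>
  have right: False
    if x: "x \<in> K" and path: "braid_path M x cs" and act: "active M c x"
      and act': "active M (Suc c) (fold flip cs x)"
      and IH: "\<And>x ds c c'. length ds < length cs \<Longrightarrow> x \<in> K \<Longrightarrow> braid_path M x ds \<Longrightarrow> active M c x
        \<Longrightarrow> active M c' (fold flip ds x) \<Longrightarrow> c' \<noteq> Suc c \<and> c \<noteq> Suc c'" for x cs c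
  proof -
    have far: "e + 2 \<le> c \<or> c + 3 \<le> e" if e: "e \<in> set cs" for e
    proof -
      obtain as bs where cs: "cs = as @ e # bs" using split_list[OF e] by blast
      let ?y = "fold flip as x"
      have p: "braid_path M x as" "active M e ?y" "braid_path M (flip e ?y) bs"
        using path by (auto simp: cs)
      have y: "?y \<in> K" "flip e ?y \<in> K"
        using fold_flip_closed[OF x p(1)] flip_closed p(2) by auto
      have "e \<noteq> Suc c" "c \<noteq> Suc e"
        using IH[OF _ x p(1) act p(2)] by (auto simp: cs)
      \<comment> \<open>A move keeps its own shadow, so after it the rest of the path is a shorter instance.\<close>
      moreover have "Suc c \<noteq> Suc e" "e \<noteq> Suc (Suc c)"
        using IH[OF _ y(2) p(3) active_flip[OF p(2)], of "Suc c"] act' by (auto simp: cs)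
      ultimately show ?thesis by linarith
    qed
    define ds where "ds = filter (\<lambda>e. e \<in> {c + 2..}) cs"
    have R: "braid_path M x ds"
      "\<And>k. fold flip ds x ! k = (if k \<in> {c + 2..} then fold flip cs x ! k else x ! k)"
    proof -
      have "{e - 1, e, e + 1} \<subseteq> {c + 2..} \<or> {e - 1, e, e + 1} \<inter> {c + 2..} = {}"
        if "e \<in> set cs" for e
        using far[OF that] by auto
      then show "braid_path M x ds"
        "\<And>k. fold flip ds x ! k = (if k \<in> {c + 2..} then fold flip cs x ! k else x ! k)"
        using braid_path_restrict[OF path HOL.refl HOL.refl, of "{c + 2..}"] unfolding ds_def by blast+
    qed
    have c: "fold flip cs x ! c = x ! c"
    proof (rule fold_flip_untouched[OF path])
      show "c \<notin> {e - 1, e, e + 1}" if "e \<in> set cs" for e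
        using far[OF that] by auto
    qed
    have idx: "c - 1 \<notin> {c + 2..}" "c \<notin> {c + 2..}" "c + 1 \<notin> {c + 2..}" by auto
    have "active M c (fold flip ds x) = active M c x"
      by (simp only: active_def length_fold_flip R(2) idx if_False)
    then have "active M c (fold flip ds x)" using act by simp
    moreover have "fold flip ds x ! (c + 2) = fold flip ds x ! c"
      using act' c by (simp add: R(2)) (simp add: active_def)
    moreover have "c + 2 < length (fold flip ds x)"
      using act' by (simp add: active_def)
    ultimately show False
      using no_alternating_four[OF fold_flip_closed[OF x R(1)]] by blast
  qed
  have 1: "c' \<noteq> Suc c"
    using right[OF less.prems(1-3)] less.prems(4) less.hyps by blast
  have 2: "c \<noteq> Suc c'"
  proof
    assume "c = Suc c'"
    then show False
      using right[of "fold flip cs x" "rev cs" c'] braid_path_rev[OF less.prems(2)]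
        fold_flip_closed[OF less.prems(1,2)] less.prems(3,4) less.hyps by auto
  qed
  show ?case using 1 2 by simp
qed

definition centers :: "nat set" where
  "centers = {c. \<exists>x\<in>K. active M c x}"

lemma centers_not_adjacent:
  assumes "c \<in> centers" "c' \<in> centers" shows "c' \<noteq> Suc c"
proof -
  obtain x y where "x \<in> K" "active M c x" "y \<in> K" "active M c' y" using assms by (auto simp: centers_def)
  then show ?thesis using connected[of x y] centers_not_adjacent_path by blast
qed

lemma centers_pos: "c \<in> centers \<Longrightarrow> 1 \<le> c"
  by (auto simp: centers_def active_def)

lemma finite_centers: "finite centers"
proof -
  obtain a where a: "a \<in> K" using rooted by blast
  have "length x = length a" if "x \<in> K" for x
    using connected[OF a that] by auto
  then have "centers \<subseteq> {..<length a}"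
    using activeD(2) by (fastforce simp: centers_def)
  then show ?thesis by (rule finite_subset) simp
qed

lemma path_centers: "x \<in> K \<Longrightarrow> braid_path M x cs \<Longrightarrow> set cs \<subseteq> centers"
  by (induction cs arbitrary: x) (auto simp: centers_def dest: flip_closed)

text \<open>
  As no two centers are adjacent, only a move at \<open>c\<close> itself changes the letter at a center \<open>c\<close>,
  although the shadows at \<open>c\<close> and \<open>c + 2\<close> may share the position \<open>c + 1\<close>.
\<close>

lemma center_not_touched:
  assumes "c \<in> centers" "e \<in> centers" "c \<noteq> e" shows "c \<notin> {e - 1, e, e + 1}"
  using assms centers_not_adjacent[of c e] centers_not_adjacent[of e c] centers_pos[of e] by auto

text \<open>
  A move at \<open>c\<close> on the path cuts it into two shorter ones. Otherwise the center letter is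
  constant, and the left letter can change only through moves at \<open>c - 2\<close>. By the induction
  hypothesis, applied to the part of the path between the first and the last such move, they all
  exchange the same pair of letters; so the old and the new left letter are related by \<open>M\<close>, and
  both are related to the center letter.
\<close>

lemma shadow_pair_path:
  assumes "x \<in> K" "braid_path M x cs" "active M c x" "active M c (fold flip cs x)"
  shows "{fold flip cs x ! (c - 1), fold flip cs x ! c} = {x ! (c - 1), x ! c}"
  using assms
proof (induction "length cs" arbitrary: x cs c rule: less_induct)
  case less
  let ?z = "fold flip cs x"
  note x = less.prems(1) and path = less.prems(2) and act = less.prems(3) and act' = less.prems(4)
  have c: "c \<in> centers" using x act by (auto simp: centers_def)
  have flip_pair: "{flip e y ! (e - 1), flip e y ! e} = {y ! (e - 1), y ! e}" if "active M e y" for e y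
    using that by (auto simp: flip_nth[OF that])
  show ?case
  proof (cases "c \<in> set cs")
    case True
    then obtain as bs where cs: "cs = as @ c # bs" using split_list[OF True] by blast
    let ?y = "fold flip as x"
    have p: "braid_path M x as" "active M c ?y" "braid_path M (flip c ?y) bs"
      using path by (auto simp: cs)
    have y: "?y \<in> K" "flip c ?y \<in> K"
      using fold_flip_closed[OF x p(1)] flip_closed p(2) by auto
    have y_pair: "{?y ! (c - 1), ?y ! c} = {x ! (c - 1), x ! c}"
      using less.hyps[OF _ x p(1) act p(2)] by (simp add: cs)
    have z: "?z = fold flip bs (flip c ?y)" by (simp add: cs)
    have "{?z ! (c - 1), ?z ! c} = {flip c ?y ! (c - 1), flip c ?y ! c}"
      unfolding z using act' unfolding z by (intro less.hyps[OF _ y(2) p(3) active_flip[OF p(2)]]) (simp add: cs)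
    also note flip_pair[OF p(2)]
    also note y_pair
    finally show ?thesis .
  next
    case False
    have cc: "?z ! c = x ! c"
    proof (rule fold_flip_untouched[OF path])
      fix e assume "e \<in> set cs"
      then have "e \<in> centers" "c \<noteq> e" using path_centers[OF x path] False by auto
      then show "c \<notin> {e - 1, e, e + 1}" by (rule center_not_touched[OF c])
    qed
    have touch: "e = c - 2 \<and> 2 \<le> c" if "e \<in> set cs" "c - 1 \<in> {e - 1, e, e + 1}" for e
    proof -
      have e: "e \<in> centers" "e \<noteq> c" using that(1) path_centers[OF x path] False by auto
      show ?thesis
        using that(2) e(2) centers_not_adjacent[OF c e(1)] centers_not_adjacent[OF e(1) c]
          centers_pos[OF c] centers_pos[OF e(1)] by auto
    qed
    have "?z ! (c - 1) = x ! (c - 1)"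
    proof (rule ccontr)
      assume ne: "?z ! (c - 1) \<noteq> x ! (c - 1)"
      \<comment> \<open>The left letter of the shadow at \<open>c\<close> is the right letter of a shadow at \<open>e\<close>.\<close>
      define e where "e = c - 2"
      obtain e' where "e' \<in> set cs" "c - 1 \<in> {e' - 1, e', e' + 1}"
        using ne fold_flip_untouched[OF path, of "c - 1"] by blast
      moreover from this have "e' = c - 2 \<and> 2 \<le> c" by (rule touch)
      ultimately have e: "e \<in> set cs" "c - 1 = e + 1" by (auto simp: e_def)
      have touch_e: "e + 1 \<notin> {d - 1, d, d + 1}" if "d \<in> set cs" "d \<noteq> e" for d
        using touch[OF that(1)] that(2) e(2) e_def by metis
      obtain as bs where cs: "cs = as @ e # bs" "e \<notin> set as" using split_list_first[OF e(1)] by blast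
      let ?y = "fold flip as x"
      have p: "braid_path M x as" "active M e ?y" "braid_path M (flip e ?y) bs"
        using path by (auto simp: cs)
      have y: "flip e ?y \<in> K"
        using fold_flip_closed[OF x p(1)] flip_closed p(2) by auto
      have first: "x ! (e + 1) = ?y ! (e - 1)"
      proof -
        have "?y ! (e + 1) = x ! (e + 1)"
          using cs(2) by (intro fold_flip_untouched[OF p(1)] touch_e) (auto simp: cs(1))
        then show ?thesis using activeD(3)[OF p(2)] by simp
      qed
      have last: "?z ! (e + 1) \<in> {?y ! (e - 1), ?y ! e}"
      proof (cases "e \<in> set bs")
        case False
        have "?z ! (e + 1) = flip e ?y ! (e + 1)"
          unfolding cs(1) fold_append fold_Cons comp_apply
          using False by (intro fold_flip_untouched[OF p(3)] touch_e) (auto simp: cs(1))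
        then show ?thesis by (simp add: flip_nth[OF p(2)])
      next
        case True
        then obtain ds fs where bs: "bs = ds @ e # fs" "e \<notin> set fs" using split_list_last[OF True] by blast
        let ?w = "fold flip ds (flip e ?y)"
        have q: "braid_path M (flip e ?y) ds" "active M e ?w" "braid_path M (flip e ?w) fs"
          using p(3) by (auto simp: bs)
        have "?z ! (e + 1) = flip e ?w ! (e + 1)"
          unfolding cs(1) bs(1) fold_append fold_Cons comp_apply
          using bs(2) by (intro fold_flip_untouched[OF q(3)] touch_e) (auto simp: cs(1) bs(1))
        also have "\<dots> = ?w ! e" by (simp add: flip_nth[OF q(2)])
        finally have "?z ! (e + 1) = ?w ! e" .
        moreover have "{?w ! (e - 1), ?w ! e} = {?y ! (e - 1), ?y ! e}"
          using less.hyps[OF _ y q(1) active_flip[OF p(2)] q(2)] flip_pair[OF p(2)]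
          by (simp add: cs(1) bs(1))
        ultimately show ?thesis by blast
      qed
      have "M (?y ! (e - 1)) (?y ! e)" using activeD(4)[OF p(2)] .
      then have "M (x ! (c - 1)) (?z ! (c - 1))"
        using first last ne unfolding e(2) by auto
      moreover have "M (?z ! (c - 1)) (x ! c)" "M (x ! (c - 1)) (x ! c)"
        using act act' cc unfolding active_def by metis+
      ultimately show False using M_triangle_free by blast
    qed
    then show ?thesis using cc by simp
  qed
qed

section \<open>The braid graph distance is the Hamming distance of the signatures\<close>

lemma letter_changes_once:
  assumes "x \<in> K" "braid_path M x cs" "distinct cs" "c \<in> set cs"
  shows "fold flip cs x ! c \<noteq> x ! c"
proof (rule once_touched_letter_changes[OF assms(2) M_irrefl assms(3,4)])
  fix e assume "e \<in> set cs" "e \<noteq> c"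
  then show "c \<notin> {e - 1, e, e + 1}"
    using path_centers[OF assms(1,2)] assms(4) by (intro center_not_touched) auto
qed simp

text \<open>
  Take an innermost repetition of a center \<open>c\<close>. At both of its occurrences the shadow at \<open>c\<close>
  shows the same pair and the same center letter, hence the same three letters. A center on the
  stretch in between that overlaps the shadow would be \<open>c - 2\<close> or \<open>c + 2\<close> and would be used
  once, changing an outer letter. So that stretch commutes with the move at \<open>c\<close>, and the two
  occurrences of \<open>c\<close> cancel.
\<close>

lemma repetition_shortens:
  assumes "x \<in> K" "braid_path M x cs" "\<not> distinct cs"
  shows "\<exists>ds. braid_path M x ds \<and> fold flip ds x = fold flip cs x \<and> length ds < length cs"
proof -
  obtain as c bs es where cs: "cs = as @ c # bs @ c # es" "distinct bs" "c \<notin> set bs"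
    using innermost_repetition[OF assms(3)] by blast
  let ?y = "fold flip as x"
  let ?w = "fold flip bs (flip c ?y)"
  have p: "braid_path M x as" "active M c ?y" "braid_path M (flip c ?y) bs" "active M c ?w"
    "braid_path M (flip c ?w) es"
    using assms(2) by (auto simp: cs)
  have y: "?y \<in> K" "flip c ?y \<in> K"
    using fold_flip_closed[OF assms(1) p(1)] flip_closed p(2) by auto
  have c: "c \<in> centers" using y p(2) by (auto simp: centers_def)
  have bs: "e \<in> centers" "e \<noteq> c" "e \<noteq> Suc c" "c \<noteq> Suc e" if "e \<in> set bs" for e
    using that path_centers[OF y(2) p(3)] cs(3) centers_not_adjacent[OF c, of e]
      centers_not_adjacent[OF _ c, of e] by auto
  have pos: "1 \<le> c" using activeD(1)[OF p(2)] .
  have center: "?w ! c = flip c ?y ! c"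
    using bs(1,2) by (intro fold_flip_untouched[OF p(3)] center_not_touched[OF c]) auto
  have "{?w ! (c - 1), ?w ! c} = {flip c ?y ! (c - 1), flip c ?y ! c}"
    using shadow_pair_path[OF y(2) p(3) active_flip[OF p(2)] p(4)] .
  then have left: "?w ! (c - 1) = flip c ?y ! (c - 1)"
    using center by (auto simp: doubleton_eq_iff)
  then have right: "?w ! (c + 1) = flip c ?y ! (c + 1)"
    using activeD(3)[OF p(4)] activeD(3)[OF active_flip[OF p(2)]] by simp
  have below: "e + 1 \<noteq> c - 1" if e: "e \<in> set bs" for e
  proof
    assume k: "e + 1 = c - 1"
    have "c - 1 \<in> {e - 1, e, e + 1}" using k by simp
    moreover have "c - 1 \<notin> {d - 1, d, d + 1}" if d: "d \<in> set bs" "d \<noteq> e" for d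
    proof -
      have "1 \<le> d" using bs(1)[OF d(1)] centers_pos by blast
      then have "c - 1 \<noteq> d - 1 \<and> c - 1 \<noteq> d \<and> c - 1 \<noteq> d + 1"
        using bs(2-4)[OF d(1)] d(2) k pos by presburger
      then show ?thesis by blast
    qed
    ultimately have "?w ! (c - 1) \<noteq> flip c ?y ! (c - 1)"
      by (rule once_touched_letter_changes[OF p(3) M_irrefl cs(2) e])
    then show False using left by simp
  qed
  have above: "e - 1 \<noteq> c + 1" if e: "e \<in> set bs" for e
  proof
    assume k: "e - 1 = c + 1"
    have "c + 1 \<in> {e - 1, e, e + 1}" using k by simp
    moreover have "c + 1 \<notin> {d - 1, d, d + 1}" if d: "d \<in> set bs" "d \<noteq> e" for d
    proof -
      have "1 \<le> d" using bs(1)[OF d(1)] centers_pos by blast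
      then have "c + 1 \<noteq> d - 1 \<and> c + 1 \<noteq> d \<and> c + 1 \<noteq> d + 1"
        using bs(2-4)[OF d(1)] d(2) k pos by presburger
      then show ?thesis by blast
    qed
    ultimately have "?w ! (c + 1) \<noteq> flip c ?y ! (c + 1)"
      by (rule once_touched_letter_changes[OF p(3) M_irrefl cs(2) e])
    then show False using right by simp
  qed
  have far: "{e - 1, e, e + 1} \<inter> {c - 1, c, c + 1} = {}" if "e \<in> set bs" for e
  proof -
    have "e + 2 < c \<or> c + 2 < e"
      using below[OF that] above[OF that] bs[OF that] centers_pos[of e] pos
      by linarith
    then show ?thesis by auto
  qed
  define P where "P = - {c - 1, c, c + 1}"
  have sub: "{e - 1, e, e + 1} \<subseteq> P" if "e \<in> set bs" for e
    using far[OF that] by (auto simp: P_def)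
  then have filt: "filter (\<lambda>e. e \<in> P) bs = bs" by (auto simp: filter_id_conv)
  have R: "braid_path M ?y bs" "\<And>k. fold flip bs ?y ! k = (if k \<in> P then ?w ! k else ?y ! k)"
  proof -
    have "?y ! k = flip c ?y ! k" if "k \<in> P" for k
      using that by (simp add: flip_nth[OF p(2)] P_def)
    then show "braid_path M ?y bs" "\<And>k. fold flip bs ?y ! k = (if k \<in> P then ?w ! k else ?y ! k)"
      using braid_path_restrict[OF p(3), of ?y P] sub unfolding filt by simp_all
  qed
  have "fold flip bs ?y = flip c ?w"
  proof (rule nth_equalityI)
    fix k
    have w: "?w ! (c - 1) = ?y ! c" "?w ! c = ?y ! (c - 1)"
      using left center pos by (simp_all add: flip_nth[OF p(2)])
    consider "k = c" | "k = c - 1" "k \<noteq> c" | "k = c + 1" | "k \<in> P" by (auto simp: P_def)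
    then show "fold flip bs ?y ! k = flip c ?w ! k"
    proof cases
      case 1
      then show ?thesis using w(1) by (simp add: R(2) P_def flip_nth[OF p(4)])
    next
      case 2
      then show ?thesis using w(2) by (simp add: R(2) P_def flip_nth[OF p(4)])
    next
      case 3
      then show ?thesis
        using w(2) activeD(3)[OF p(2)] by (simp add: R(2) P_def flip_nth[OF p(4)])
    next
      case 4
      then have "k \<noteq> c" "\<not> (k = c - 1 \<or> k = c + 1)" by (auto simp: P_def)
      then show ?thesis using 4 by (simp only: R(2) flip_nth[OF p(4)] if_True if_False)
    qed
  qed simp
  then have "braid_path M x (as @ bs @ es)" "fold flip (as @ bs @ es) x = fold flip cs x"
    using p R(1) by (simp_all add: cs)
  then show ?thesis by (intro exI[of _ "as @ bs @ es"]) (simp add: cs)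
qed

text \<open>
  Words are compared at the centers only, which are the positions recorded in the signature.
\<close>

definition hamming :: "'a list \<Rightarrow> 'a list \<Rightarrow> nat" where
  "hamming x y = card {c \<in> centers. x ! c \<noteq> y ! c}"

lemma center_outside_path:
  assumes "x \<in> K" "braid_path M x cs" "c \<in> centers" "c \<notin> set cs"
  shows "fold flip cs x ! c = x ! c"
proof (rule fold_flip_untouched[OF assms(2)])
  fix e assume "e \<in> set cs"
  then show "c \<notin> {e - 1, e, e + 1}"
    using path_centers[OF assms(1,2)] assms(4) by (intro center_not_touched[OF assms(3)]) auto
qed

lemma path_length_ge_hamming:
  assumes "x \<in> K" "braid_path M x cs"
  shows "hamming x (fold flip cs x) \<le> length cs"
proof -
  have "{c \<in> centers. x ! c \<noteq> fold flip cs x ! c} \<subseteq> set cs"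
    using center_outside_path[OF assms] by fastforce
  then have "hamming x (fold flip cs x) \<le> card (set cs)"
    unfolding hamming_def by (intro card_mono) auto
  then show ?thesis using card_length[of cs] by linarith
qed

text \<open>
  A path of minimal length is repetition-free, so the centers on it are exactly the ones where
  its endpoints differ.
\<close>

lemma hamming_path:
  assumes "x \<in> K" "y \<in> K"
  shows "\<exists>cs. braid_path M x cs \<and> fold flip cs x = y \<and> length cs = hamming x y"
proof -
  define path where "path cs \<longleftrightarrow> braid_path M x cs \<and> fold flip cs x = y" for cs
  obtain cs0 where "path cs0" using connected[OF assms] unfolding path_def by blast
  then obtain cs where cs: "path cs" "\<And>ds. path ds \<Longrightarrow> length cs \<le> length ds"
    using ex_has_least_nat[of path cs0 length] by blast
  have p: "braid_path M x cs" "fold flip cs x = y" using cs(1) by (auto simp: path_def)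
  have d: "distinct cs"
  proof (rule ccontr)
    assume "\<not> distinct cs"
    then obtain ds where "path ds" "length ds < length cs"
      using repetition_shortens[OF assms(1) p(1)] p(2) by (auto simp: path_def)
    then show False using cs(2) by fastforce
  qed
  have "c \<in> set cs" if "c \<in> centers" "x ! c \<noteq> y ! c" for c
    using that center_outside_path[OF assms(1) p(1)] p(2) by metis
  then have "{c \<in> centers. x ! c \<noteq> y ! c} = set cs"
    using letter_changes_once[OF assms(1) p(1) d] path_centers[OF assms(1) p(1)] p(2) by fastforce
  then show ?thesis
    using p distinct_card[OF d] by (auto simp: hamming_def)
qed

lemma flip_changes_one_center:
  assumes "x \<in> K" "active M c x" "e \<in> centers"
  shows "flip c x ! e \<noteq> x ! e \<longleftrightarrow> e = c"
proof -
  have c: "c \<in> centers" using assms by (auto simp: centers_def)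
  show ?thesis
  proof (cases "e = c")
    case True
    then show ?thesis using active_letter_changes[OF assms(2) M_irrefl, of c] by simp
  next
    case False
    then show ?thesis using center_not_touched[OF assms(3) c] by (simp add: flip_nth[OF assms(2)])
  qed
qed

lemma shadow_pair:
  assumes "x \<in> K" "y \<in> K" "active M c x" "active M c y"
  shows "{y ! (c - 1), y ! c} = {x ! (c - 1), x ! c}"
  using connected[OF assms(1,2)] shadow_pair_path[OF assms(1)] assms(3,4) by blast

lemma hamming_flip:
  assumes "a \<in> K" "active M c a"
  shows "hamming w a < hamming w (flip c a) \<longleftrightarrow> w ! c = a ! c"
proof -
  have c: "c \<in> centers" using assms by (auto simp: centers_def)
  let ?D = "\<lambda>b. {e \<in> centers. w ! e \<noteq> b ! e}"
  have fin: "finite (?D b)" for b using finite_centers by simp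
  have ne: "flip c a ! c \<noteq> a ! c" using flip_changes_one_center[OF assms c] by simp
  have rest: "flip c a ! e = a ! e" if "e \<in> centers" "e \<noteq> c" for e
    using flip_changes_one_center[OF assms that(1)] that(2) by simp
  show ?thesis
  proof (cases "w ! c = a ! c")
    case True
    then have "c \<notin> ?D a" "c \<in> ?D (flip c a)" using c ne by auto
    moreover have "?D a \<subseteq> ?D (flip c a)" using True rest by (auto, metis)
    ultimately have "?D a \<subset> ?D (flip c a)" by blast
    then show ?thesis using True psubset_card_mono[OF fin] by (simp add: hamming_def)
  next
    case False
    then have "?D (flip c a) \<subseteq> ?D a" using rest by (auto, metis)
    then show ?thesis using False card_mono[OF fin] by (simp add: hamming_def linorder_not_less)
  qed
qed

end

section \<open>Braid moves preserve reduced expressions\<close>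

abbreviation generator_word :: "'a list \<Rightarrow> ('a \<times> bool) list" where
  "generator_word \<equiv> map (\<lambda>s. (s, True))"

abbreviation coxeter_eq :: "'a set \<Rightarrow> ('a \<Rightarrow> 'a \<Rightarrow> enat) \<Rightarrow> 'a list \<Rightarrow> 'a list \<Rightarrow> bool" where
  "coxeter_eq S m u v \<equiv> pres_eq S (coxeter_relators S m) (generator_word u) (generator_word v)"

lemma generator_word_signed: "u \<in> lists S \<Longrightarrow> generator_word u \<in> signed_words S"
  by (auto simp: signed_words_def in_lists_conv_set)

lemma word_value_eq_class:
  "u \<in> lists S \<Longrightarrow> word_value S m u = pres_rel S (coxeter_relators S m) `` {generator_word u}"
proof (induction u)
  case Nil
  then show ?case by (simp add: word_value_def coxeter_group_def presented_group_def)
next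
  case (Cons s u)
  have "[(s, True)] \<in> signed_words S" using Cons.prems by (auto simp: signed_words_def)
  moreover have "generator_word u \<in> signed_words S" using Cons.prems by (auto intro: generator_word_signed)
  ultimately show ?case
    using Cons by (simp add: word_value_def coxeter_group_def coxeter_gen_def presented_group_mult)
qed

lemma word_value_cong:
  assumes "u \<in> lists S" "v \<in> lists S" "coxeter_eq S m u v"
  shows "word_value S m u = word_value S m v"
  using assms equiv_class_eq[OF equiv_pres_rel, of "generator_word u" "generator_word v" S]
  by (simp add: word_value_eq_class pres_rel_def)

lemma coxeter_eq_relator:
  assumes "u \<in> lists S" "v \<in> lists S" "s \<in> S" "t \<in> S" "m s t = enat k"
  shows "coxeter_eq S m (u @ concat (replicate k [s, t]) @ v) (u @ v)"
proof -
  let ?r = "concat (replicate k [(s, True), (t, True)])"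
  have "generator_word (concat (replicate k [s, t])) = ?r"
    by (simp add: map_concat)
  moreover have "?r \<in> coxeter_relators S m"
    using assms(3-5) by (auto simp: coxeter_relators_def)
  moreover have "?r \<in> signed_words S"
    using assms(3,4) by (auto simp: signed_words_def in_lists_conv_set)
  ultimately show ?thesis
    using pres_eq.relator[of "generator_word u" S "generator_word v" ?r] assms(1,2)
    by (simp add: generator_word_signed)
qed

lemma coxeter_eq_square:
  assumes "coxeter_matrix S m" "u \<in> lists S" "v \<in> lists S" "s \<in> S"
  shows "coxeter_eq S m (u @ [s, s] @ v) (u @ v)"
proof -
  have "m s s = enat 1" using assms(1,4) by (simp add: coxeter_matrix_def one_enat_def)
  then show ?thesis using coxeter_eq_relator[of u S v s s m 1] assms by simp
qed

text \<open>
  Inserting \<open>(tst)(tst) = e\<close> after \<open>sts\<close>, one square at a time, creates the relator \<open>(st)\<^sup>3\<close> and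
  leaves \<open>tst\<close>.
\<close>

lemma coxeter_eq_braid:
  assumes "coxeter_matrix S m" "u \<in> lists S" "v \<in> lists S" "s \<in> S" "t \<in> S" "m s t = 3"
  shows "coxeter_eq S m (u @ [s, t, s] @ v) (u @ [t, s, t] @ v)"
proof -
  note [trans] = pres_eq.trans
  have "coxeter_eq S m (u @ [s, t, s] @ v) (u @ [s, t, s, t, t] @ v)"
    using coxeter_eq_square[of S m "u @ [s, t, s]" v t] assms by (auto intro: pres_eq.sym)
  also have "coxeter_eq S m (u @ [s, t, s, t, t] @ v) (u @ [s, t, s, t, s, s, t] @ v)"
    using coxeter_eq_square[of S m "u @ [s, t, s, t]" "[t] @ v" s] assms by (auto intro: pres_eq.sym)
  also have "coxeter_eq S m (u @ [s, t, s, t, s, s, t] @ v) (u @ [s, t, s, t, s, t, t, s, t] @ v)"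
    using coxeter_eq_square[of S m "u @ [s, t, s, t, s]" "[s, t] @ v" t] assms by (auto intro: pres_eq.sym)
  also have "coxeter_eq S m (u @ [s, t, s, t, s, t, t, s, t] @ v) (u @ [t, s, t] @ v)"
    using coxeter_eq_relator[of u S "[t, s, t] @ v" s t m 3] assms
    by (simp add: numeral_eq_enat numeral_3_eq_3)
  finally show ?thesis .
qed

text \<open>
  A braid move turns \<open>stst\<close> into \<open>tstt\<close>, which cancels to \<open>ts\<close>.
\<close>

lemma reduced_no_alternating_four:
  assumes "coxeter_matrix S m" "s \<in> S" "t \<in> S" "m s t = 3"
  shows "\<not> reduced_expr S m (u @ [s, t, s, t] @ v)"
proof
  assume red: "reduced_expr S m (u @ [s, t, s, t] @ v)"
  then have w: "u \<in> lists S" "v \<in> lists S" by (auto simp: reduced_expr_def)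
  have "coxeter_eq S m (u @ [s, t, s, t] @ v) (u @ [t, s, t, t] @ v)"
    using coxeter_eq_braid[of S m u "[t] @ v" s t] w assms by simp
  moreover have "coxeter_eq S m (u @ [t, s, t, t] @ v) (u @ [t, s] @ v)"
    using coxeter_eq_square[of S m "u @ [t, s]" v t] w assms by simp
  ultimately have "coxeter_eq S m (u @ [s, t, s, t] @ v) (u @ [t, s] @ v)"
    by (rule pres_eq.trans)
  then have "word_value S m (u @ [s, t, s, t] @ v) = word_value S m (u @ [t, s] @ v)"
    using w assms by (intro word_value_cong) auto
  then show False using red w assms by (auto simp: reduced_expr_def dest!: bspec[of _ _ "u @ [t, s] @ v"])
qed

lemma braid_move_reduced:
  assumes "coxeter_matrix S m" "braid_move S m x y" "reduced_expr S m x"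
  shows "reduced_expr S m y"
proof -
  obtain u v s t where st: "s \<in> S" "t \<in> S" "m s t = 3" "x = u @ [s, t, s] @ v" "y = u @ [t, s, t] @ v"
    using assms(2) by (auto simp: braid_move_def braid_move_at_def)
  have x: "x \<in> lists S" using assms(3) by (simp add: reduced_expr_def)
  have uv: "u \<in> lists S" "v \<in> lists S" using x st by auto
  have y: "y \<in> lists S" using uv st by auto
  have "coxeter_eq S m x y"
    unfolding st(4,5) using coxeter_eq_braid[OF assms(1) uv st(1-3)] .
  then have "word_value S m x = word_value S m y" by (rule word_value_cong[OF x y])
  moreover have "length x = length y" by (simp add: st)
  ultimately show ?thesis using assms(3) y by (simp add: reduced_expr_def)
qed

lemma braid_move_sym:
  assumes "coxeter_matrix S m" "braid_move S m x y" shows "braid_move S m y x"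
  using assms unfolding braid_move_def braid_move_at_def coxeter_matrix_def by metis

lemma braid_class_eq:
  assumes "coxeter_matrix S m" "y \<in> braid_class S m x"
  shows "braid_class S m y = braid_class S m x"
proof -
  have "(braid_move S m)\<^sup>*\<^sup>* x y" using assms(2) by (simp add: braid_class_def)
  moreover from this have "(braid_move S m)\<^sup>*\<^sup>* y x"
    by (induction rule: rtranclp_induct) (auto intro: converse_rtranclp_into_rtranclp braid_move_sym[OF assms(1)])
  ultimately show ?thesis unfolding braid_class_def by (meson rtranclp_trans)
qed

definition braid_related :: "'a set \<Rightarrow> ('a \<Rightarrow> 'a \<Rightarrow> enat) \<Rightarrow> 'a \<Rightarrow> 'a \<Rightarrow> bool" where
  "braid_related S m s t \<longleftrightarrow> s \<in> S \<and> t \<in> S \<and> m s t = 3"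

lemma split_three:
  assumes "1 \<le> c" "c + 1 < length x"
  shows "x = take (c - 1) x @ [x ! (c - 1), x ! c, x ! (c + 1)] @ drop (c + 2) x"
proof -
  have "drop (c - 1) x = x ! (c - 1) # drop c x" using Cons_nth_drop_Suc[of "c - 1" x] assms by simp
  moreover have "drop c x = x ! c # drop (c + 1) x" using Cons_nth_drop_Suc[of c x] assms by simp
  moreover have "drop (c + 1) x = x ! (c + 1) # drop (c + 2) x"
    using Cons_nth_drop_Suc[of "c + 1" x] assms by simp
  ultimately show ?thesis using append_take_drop_id[of "c - 1" x] by simp
qed

lemma flip_append: "flip (length u + 1) (u @ [s, t, s] @ v) = u @ [t, s, t] @ v"
  by (simp add: flip_def nth_append list_update_append)

lemma braid_move_at_iff_flip:
  "braid_move_at S m c x y \<longleftrightarrow> active (braid_related S m) c x \<and> y = flip c x"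
proof
  assume "braid_move_at S m c x y"
  then obtain u v s t where "s \<in> S" "t \<in> S" "m s t = 3" "c = length u + 1"
    "x = u @ [s, t, s] @ v" "y = u @ [t, s, t] @ v"
    by (auto simp: braid_move_at_def)
  then show "active (braid_related S m) c x \<and> y = flip c x"
    using flip_append[of u s t v] by (auto simp: active_def braid_related_def nth_append)
next
  assume act: "active (braid_related S m) c x \<and> y = flip c x"
  let ?u = "take (c - 1) x" and ?v = "drop (c + 2) x" and ?s = "x ! (c - 1)" and ?t = "x ! c"
  have x: "x = ?u @ [?s, ?t, ?s] @ ?v" and c: "c = length ?u + 1"
    using act split_three[of c x] activeD[of "braid_related S m" c x] by auto
  have "y = ?u @ [?t, ?s, ?t] @ ?v"
    using flip_append[of ?u ?s ?t ?v] act x c by metis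
  then show "braid_move_at S m c x y"
    using act x c activeD(4)[of "braid_related S m" c x]
    unfolding braid_move_at_def braid_related_def by blast
qed

lemma braid_move_iff_flip:
  "braid_move S m x y \<longleftrightarrow> (\<exists>c. active (braid_related S m) c x \<and> y = flip c x)"
  by (simp add: braid_move_def braid_move_at_iff_flip)

lemma braid_words_class:
  assumes "coxeter_matrix S m" "type_Lambda S m" "reduced_expr S m \<alpha>"
  shows "braid_words (braid_related S m) (braid_class S m \<alpha>)"
proof
  let ?M = "braid_related S m" and ?K = "braid_class S m \<alpha>"
  show "?M b a" if "?M a b" for a b
    using that assms(1) by (simp add: braid_related_def coxeter_matrix_def)
  show "\<not> ?M a a" for a
    using assms(1) by (auto simp: braid_related_def coxeter_matrix_def)
  show "\<not> ?M a d" if "?M a b" "?M b d" for a b d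
  proof
    assume "?M a d"
    have edge: "{p, q} \<in> edges (coxeter_graph S m) \<and> p \<noteq> q" if "?M p q" for p q
    proof
      have pq: "p \<in> S" "q \<in> S" "m p q = 3" using that by (auto simp: braid_related_def)
      then show "{p, q} \<in> edges (coxeter_graph S m)"
        unfolding coxeter_graph_def by force
      show "p \<noteq> q" using pq assms(1) by (auto simp: coxeter_matrix_def)
    qed
    then show False
      using assms(2) edge[OF that(1)] edge[OF that(2)] edge[OF \<open>?M a d\<close>]
      unfolding type_Lambda_def triangle_free_def by fastforce
  qed
  show "flip c x \<in> ?K" if "x \<in> ?K" "active ?M c x" for x c
  proof -
    have "braid_move S m x (flip c x)" using that(2) braid_move_iff_flip by blast
    then show ?thesis
      using that(1) braid_move_reduced[OF assms(1)]
      by (auto simp: braid_class_def intro: rtranclp.rtrancl_into_rtrancl)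
  qed
  show "x ! (c + 2) \<noteq> x ! c" if "x \<in> ?K" "active ?M c x" "c + 2 < length x" for x c
  proof
    assume four: "x ! (c + 2) = x ! c"
    note act = activeD[OF that(2)]
    have "drop (c + 2) x = x ! c # drop (c + 3) x"
      using Cons_nth_drop_Suc[OF that(3)] four by (simp add: numeral_3_eq_3)
    then have "x = take (c - 1) x @ [x ! (c - 1), x ! c, x ! (c - 1), x ! c] @ drop (c + 3) x"
      using split_three[OF act(1,2)] act(3) by simp
    then show False
      using that(1) act(4) reduced_no_alternating_four[OF assms(1)]
      unfolding braid_class_def braid_related_def by (metis mem_Collect_eq)
  qed
  show "\<exists>a\<in>?K. \<forall>x\<in>?K. \<exists>cs. braid_path ?M a cs \<and> fold flip cs a = x"
  proof (intro bexI[of _ \<alpha>] ballI)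
    show "\<alpha> \<in> ?K" using assms(3) by (simp add: braid_class_def)
    fix x assume "x \<in> ?K"
    then have "(braid_move S m)\<^sup>*\<^sup>* \<alpha> x" by (simp add: braid_class_def)
    then show "\<exists>cs. braid_path ?M \<alpha> cs \<and> fold flip cs \<alpha> = x"
    proof (induction rule: rtranclp_induct)
      case base
      then show ?case by (intro exI[of _ "[]"]) simp
    next
      case (step y z)
      then obtain cs c where "braid_path ?M \<alpha> cs" "fold flip cs \<alpha> = y" "active ?M c y" "z = flip c y"
        unfolding braid_move_iff_flip by blast
      then show ?case by (intro exI[of _ "cs @ [c]"]) simp
    qed
  qed
qed

section \<open>Braid graphs in type \<open>\<Lambda>\<close>\<close>

locale type_Lambda_class =
  fixes S :: "'a set" and m :: "'a \<Rightarrow> 'a \<Rightarrow> enat" and \<alpha> :: "'a list"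
  assumes matrix: "coxeter_matrix S m" and Lambda: "type_Lambda S m" and reduced: "reduced_expr S m \<alpha>"
begin

abbreviation M where "M \<equiv> braid_related S m"
abbreviation K where "K \<equiv> braid_class S m \<alpha>"
abbreviation G where "G \<equiv> braid_graph S m \<alpha>"

sublocale braid_words M K
  using braid_words_class[OF matrix Lambda reduced] .

lemma edge_iff_flip: "{x, y} \<in> edges G \<longleftrightarrow> x \<in> K \<and> (\<exists>c. active M c x \<and> y = flip c x)"
proof -
  have "{x, y} \<in> edges G \<longleftrightarrow> x \<in> K \<and> y \<in> K \<and> braid_move S m x y"
    using braid_move_sym[OF matrix] by (auto simp: braid_graph_def doubleton_eq_iff)
  then show ?thesis using flip_closed by (auto simp: braid_move_iff_flip)
qed

lemma vertices_G: "vertices G = K"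
  by (simp add: braid_graph_def)

lemma walk_to_path:
  "walk G u p v \<Longrightarrow> \<exists>cs. braid_path M u cs \<and> fold flip cs u = v \<and> length cs = length p - 1"
proof (induction p arbitrary: u)
  case Nil
  then show ?case by (simp add: walk_def)
next
  case (Cons w q)
  show ?case
  proof (cases q)
    case Nil
    then show ?thesis using Cons.prems by (intro exI[of _ "[]"]) (auto simp: walk_def)
  next
    case (Cons w' q')
    then have uw: "u = w" "{u, w'} \<in> edges G" and tail: "walk G w' q v"
      using Cons.prems by (auto simp: walk_def)
    then obtain c where "active M c u" "w' = flip c u" using edge_iff_flip by blast
    moreover obtain cs where "braid_path M w' cs" "fold flip cs w' = v" "length cs = length q - 1"
      using Cons.IH[OF tail] by blast
    ultimately show ?thesis using Cons by (intro exI[of _ "c # cs"]) simp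
  qed
qed

lemma path_to_walk:
  "u \<in> K \<Longrightarrow> braid_path M u cs \<Longrightarrow> \<exists>p. walk G u p (fold flip cs u) \<and> length p = length cs + 1"
proof (induction cs arbitrary: u)
  case Nil
  then show ?case by (intro exI[of _ "[u]"]) (simp add: walk_def vertices_G)
next
  case (Cons c cs)
  have c: "active M c u" "braid_path M (flip c u) cs" using Cons.prems by auto
  then obtain p where p: "walk G (flip c u) p (fold flip cs (flip c u))" "length p = length cs + 1"
    using Cons.IH[OF flip_closed[OF Cons.prems(1)]] by blast
  have "{u, flip c u} \<in> edges G" using Cons.prems(1) c(1) edge_iff_flip by blast
  then have "walk G u (u # p) (fold flip cs (flip c u))"
    using p(1) Cons.prems(1) by (cases p) (auto simp: walk_def vertices_G)
  then show ?case using p(2) by (intro exI[of _ "u # p"]) simp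
qed

lemma graph_dist_eq_hamming:
  assumes "x \<in> K" "y \<in> K"
  shows "graph_dist G x y = enat (hamming x y)"
proof (rule antisym)
  obtain cs where cs: "braid_path M x cs" "fold flip cs x = y" "length cs = hamming x y"
    using hamming_path[OF assms] by blast
  then obtain p where "walk G x p y" "length p = length cs + 1"
    using path_to_walk[OF assms(1) cs(1)] unfolding cs(2) by blast
  then show "graph_dist G x y \<le> enat (hamming x y)"
    unfolding graph_dist_def by (intro INF_lower2[of p]) (simp_all add: cs(3))
next
  show "enat (hamming x y) \<le> graph_dist G x y"
    unfolding graph_dist_def
  proof (rule INF_greatest)
    fix p assume "p \<in> {p. walk G x p y}"
    then obtain cs where "braid_path M x cs" "fold flip cs x = y" "length cs = length p - 1"
      using walk_to_path by blast
    then show "enat (hamming x y) \<le> enat (length p - 1)"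
      using path_length_ge_hamming[OF assms(1), of cs] by simp
  qed
qed

lemma semicube_flip:
  assumes "x \<in> K" "active M c x"
  shows "semicube G x (flip c x) = {w \<in> K. w ! c = x ! c}"
proof -
  have "graph_dist G w x < graph_dist G w (flip c x) \<longleftrightarrow> w ! c = x ! c" if "w \<in> K" for w
    using graph_dist_eq_hamming[OF that assms(1)] graph_dist_eq_hamming[OF that flip_closed[OF assms]]
      hamming_flip[OF assms] by simp
  then show ?thesis by (auto simp: semicube_def vertices_G)
qed

lemma shadow_center_eq:
  assumes "1 \<le> c" shows "shadow_center {c - 1, c, c + 1} = c"
  unfolding shadow_center_def
proof (rule the_equality)
  show "1 \<le> c \<and> {c - 1, c, c + 1} = {c - 1, c, c + 1}" using assms by simp
next
  fix i assume i: "1 \<le> i \<and> {c - 1, c, c + 1} = {i - 1, i, i + 1}"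
  have "i - 1 \<in> {c - 1, c, c + 1}" unfolding conjunct2[OF i] by simp
  moreover have "c - 1 \<in> {i - 1, i, i + 1}" unfolding conjunct2[OF i, symmetric] by simp
  ultimately show "i = c" using conjunct1[OF i] assms by auto
qed

lemma class_shadows_eq: "class_shadows S m \<alpha> = (\<lambda>c. {c - 1, c, c + 1}) ` centers"
proof -
  have "braid_shadows S m x = (\<lambda>c. {c - 1, c, c + 1}) ` {c. active M c x}" for x
  proof (intro Set.equalityI subsetI)
    fix A assume "A \<in> braid_shadows S m x"
    then obtain c s t where "A = {c - 1, c, c + 1}" "1 \<le> c" "c + 1 < length x" "s \<in> S" "t \<in> S" "m s t = 3"
      "x ! (c - 1) = s" "x ! c = t" "x ! (c + 1) = s"
      unfolding braid_shadows_def by blast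
    moreover from this have "active M c x" by (simp add: active_def braid_related_def)
    ultimately show "A \<in> (\<lambda>c. {c - 1, c, c + 1}) ` {c. active M c x}" by blast
  next
    fix A assume "A \<in> (\<lambda>c. {c - 1, c, c + 1}) ` {c. active M c x}"
    then obtain c where c: "A = {c - 1, c, c + 1}" "active M c x" by blast
    show "A \<in> braid_shadows S m x"
      unfolding braid_shadows_def mem_Collect_eq
    proof (intro exI conjI)
      show "A = {c - 1, c, c + 1}" "1 \<le> c" "c + 1 < length x" "x ! (c + 1) = x ! (c - 1)"
        using c(1) activeD(1-3)[OF c(2)] by simp_all
      show "x ! (c - 1) \<in> S" "x ! c \<in> S" "m (x ! (c - 1)) (x ! c) = 3"
        using activeD(4)[OF c(2)] by (simp_all add: braid_related_def)
    qed (rule HOL.refl)+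
  qed
  moreover have "centers = (\<Union>x\<in>K. {c. active M c x})" by (auto simp: centers_def)
  ultimately show ?thesis by (simp only: class_shadows_def image_UN)
qed

lemma shadow_centers: "shadow_center ` class_shadows S m \<alpha> = centers"
proof -
  have "shadow_center ` class_shadows S m \<alpha> = (\<lambda>c. c) ` centers"
    unfolding class_shadows_eq image_image
    by (intro image_cong shadow_center_eq centers_pos HOL.refl)
  then show ?thesis by simp
qed

lemma braid_dim_eq: "braid_dim S m \<alpha> = card centers"
proof -
  have "inj_on (\<lambda>c. {c - 1, c, c + 1}) centers"
    by (rule inj_on_inverseI[of _ shadow_center]) (use shadow_center_eq centers_pos in blast)
  then show ?thesis by (simp add: braid_dim_def class_shadows_eq card_image)
qed

lemma class_centers_eq: "class_centers S m \<alpha> = sorted_list_of_set centers"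
  by (simp add: class_centers_def shadow_centers)

lemma sig_entry_eq:
  assumes "x \<in> K" "i \<in> {1..braid_dim S m \<alpha>}"
  shows "sig_entry S m i x = x ! (class_centers S m \<alpha> ! (i - 1))"
proof -
  have "class_centers S m x = class_centers S m \<alpha>"
    using braid_class_eq[OF matrix assms(1)] by (simp add: class_centers_def class_shadows_def)
  moreover have "i - 1 < length (class_centers S m \<alpha>)"
    using assms(2) by (auto simp: class_centers_eq braid_dim_eq)
  ultimately show ?thesis by (simp add: sig_entry_def signature_def)
qed

lemma center_index_bij:
  "bij_betw (\<lambda>i. class_centers S m \<alpha> ! (i - 1)) {1..braid_dim S m \<alpha>} centers"
proof -
  have "bij_betw (\<lambda>i. i - 1) {1..card centers} {..<card centers}"
    by (rule bij_betwI[of _ _ _ Suc]) auto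
  moreover have "bij_betw (nth (sorted_list_of_set centers)) {..<card centers} centers"
    using finite_centers by (intro bij_betw_nth) auto
  ultimately show ?thesis
    unfolding class_centers_eq braid_dim_eq by (auto dest: bij_betw_trans simp: comp_def)
qed

text \<open>
  A move at another center leaves the letter at \<open>c\<close> alone. A move at \<open>c\<close> exchanges the same two
  letters in \<open>x\<close> as in \<open>a\<close>, so it takes the letter at \<open>c\<close> from one of \<open>a ! c\<close> and \<open>flip c a ! c\<close>
  to the other.
\<close>

lemma flip_crosses_iff_same_center:
  assumes "a \<in> K" "active M c a" "x \<in> K" "active M d x"
  shows "(x ! c = a ! c \<and> flip d x ! c = flip c a ! c \<or>
      flip d x ! c = a ! c \<and> x ! c = flip c a ! c) \<longleftrightarrow> d = c"
proof
  have c: "c \<in> centers" using assms(1,2) by (auto simp: centers_def)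
  assume "x ! c = a ! c \<and> flip d x ! c = flip c a ! c \<or> flip d x ! c = a ! c \<and> x ! c = flip c a ! c"
  then have "flip d x ! c \<noteq> x ! c"
    using flip_changes_one_center[OF assms(1,2) c] by auto
  then show "d = c" using flip_changes_one_center[OF assms(3,4) c] by simp
next
  assume "d = c"
  then have "{x ! (c - 1), x ! c} = {a ! (c - 1), a ! c}"
    using shadow_pair[OF assms(1,3,2)] assms(4) by simp
  then show "x ! c = a ! c \<and> flip d x ! c = flip c a ! c \<or> flip d x ! c = a ! c \<and> x ! c = flip c a ! c"
    using flip_nth[OF assms(2), of c] flip_nth[OF assms(4), of c] \<open>d = c\<close>
    unfolding doubleton_eq_iff by auto
qed

lemma cut_edge_flip_iff:
  assumes "a \<in> K" "active M c a" "x \<in> K" "active M d x"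
  shows "{x, flip d x} \<in> cut_edges G a (flip c a) \<longleftrightarrow> d = c"
proof -
  have W: "semicube G a (flip c a) = {w \<in> K. w ! c = a ! c}"
    "semicube G (flip c a) a = {w \<in> K. w ! c = flip c a ! c}"
    using semicube_flip[OF assms(1,2)] semicube_flip[OF flip_closed[OF assms(1,2)] active_flip[OF assms(2)]]
    by (simp_all add: flip_flip[OF assms(2)])
  have "{x, flip d x} \<in> edges G" using assms(3,4) edge_iff_flip by blast
  then have "{x, flip d x} \<in> cut_edges G a (flip c a) \<longleftrightarrow>
      x ! c = a ! c \<and> flip d x ! c = flip c a ! c \<or> flip d x ! c = a ! c \<and> x ! c = flip c a ! c"
    using assms(3) flip_closed[OF assms(3,4)] unfolding cut_edges_def W
    by (auto simp: doubleton_eq_iff)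
  then show ?thesis using flip_crosses_iff_same_center[OF assms] by simp
qed

lemma edge_labeled_flip_iff:
  assumes "i \<in> {1..braid_dim S m \<alpha>}" "x \<in> K" "active M d x"
  shows "edge_labeled S m \<alpha> {x, flip d x} i \<longleftrightarrow> d = class_centers S m \<alpha> ! (i - 1)"
proof -
  let ?c = "class_centers S m \<alpha> ! (i - 1)"
  have c: "?c \<in> centers" using center_index_bij assms(1) by (auto dest: bij_betwE)
  have "{x, flip d x} \<in> edges G" using assms(2,3) edge_iff_flip by blast
  then have "edge_labeled S m \<alpha> {x, flip d x} i \<longleftrightarrow>
      (\<exists>y z. {x, flip d x} = {y, z} \<and> active M ?c y \<and> z = flip ?c y)"
    using assms(1) by (simp add: edge_labeled_def braid_move_at_iff_flip)
  also have "\<dots> \<longleftrightarrow> active M ?c x \<and> flip d x = flip ?c x"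
  proof
    assume "\<exists>y z. {x, flip d x} = {y, z} \<and> active M ?c y \<and> z = flip ?c y"
    then obtain y where y: "{x, flip d x} = {y, flip ?c y}" "active M ?c y" by blast
    consider "x = y" "flip d x = flip ?c y" | "x = flip ?c y" "flip d x = y"
      using y(1) unfolding doubleton_eq_iff by blast
    then show "active M ?c x \<and> flip d x = flip ?c x"
    proof cases
      case 1
      then show ?thesis using y(2) by simp
    next
      case 2
      then show ?thesis using active_flip[OF y(2)] flip_flip[OF y(2)] by simp
    qed
  qed blast
  also have "\<dots> \<longleftrightarrow> d = ?c"
  proof
    assume "active M ?c x \<and> flip d x = flip ?c x"
    then have "flip d x ! ?c \<noteq> x ! ?c" using flip_changes_one_center[OF assms(2) _ c] by simp
    then show "d = ?c" using flip_changes_one_center[OF assms(2,3) c] by simp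
  qed (use assms(3) in simp)
  finally show ?thesis .
qed

end

theorem proposition6p1:
  fixes S :: "'a set" and m :: "'a \<Rightarrow> 'a \<Rightarrow> enat" and \<alpha> \<beta> :: "'a list"
  assumes "coxeter_matrix S m"
    and "type_Lambda S m"
    and "reduced_expr S m \<alpha>"
    and "1 \<le> braid_dim S m \<alpha>"
    and "{\<alpha>, \<beta>} \<in> edges (braid_graph S m \<alpha>)"
  shows "(\<exists>!i. i \<in> {1..braid_dim S m \<alpha>} \<and> sig_entry S m i \<alpha> \<noteq> sig_entry S m i \<beta>) \<and>
    (\<forall>i\<in>{1..braid_dim S m \<alpha>}. sig_entry S m i \<alpha> \<noteq> sig_entry S m i \<beta> \<longrightarrow>
       semicube (braid_graph S m \<alpha>) \<alpha> \<beta> = sig_fiber S m i \<alpha> \<and>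
       (\<forall>x y. {x, y} \<in> edges (braid_graph S m \<alpha>) \<longrightarrow>
          ({x, y} \<in> cut_edges (braid_graph S m \<alpha>) \<alpha> \<beta> \<longleftrightarrow> edge_labeled S m \<alpha> {x, y} i)))"
proof -
  interpret type_Lambda_class S m \<alpha> by unfold_locales (fact assms)+
  let ?c = "\<lambda>i. class_centers S m \<alpha> ! (i - 1)"
  obtain c where \<alpha>: "\<alpha> \<in> K" and c: "active M c \<alpha>" and \<beta>: "\<beta> = flip c \<alpha>"
    using assms(5) edge_iff_flip by blast
  have "\<beta> \<in> K" using flip_closed[OF \<alpha> c] \<beta> by simp
  have center: "?c i \<in> centers" if "i \<in> {1..braid_dim S m \<alpha>}" for i
    using center_index_bij that by (auto dest: bij_betwE)
  have differ: "sig_entry S m i \<alpha> \<noteq> sig_entry S m i \<beta> \<longleftrightarrow> ?c i = c"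
    if "i \<in> {1..braid_dim S m \<alpha>}" for i
  proof -
    have "\<beta> ! ?c i \<noteq> \<alpha> ! ?c i \<longleftrightarrow> ?c i = c"
      unfolding \<beta> by (rule flip_changes_one_center[OF \<alpha> c center[OF that]])
    then show ?thesis
      unfolding sig_entry_eq[OF \<alpha> that] sig_entry_eq[OF \<open>\<beta> \<in> K\<close> that] eq_commute[of "\<beta> ! _"] .
  qed
  have c_center: "c \<in> centers" using \<alpha> c by (auto simp: centers_def)
  have unique: "\<exists>!i. i \<in> {1..braid_dim S m \<alpha>} \<and> sig_entry S m i \<alpha> \<noteq> sig_entry S m i \<beta>"
  proof -
    have "c \<in> ?c ` {1..braid_dim S m \<alpha>}"
      using c_center unfolding bij_betw_imp_surj_on[OF center_index_bij] .
    then obtain i where i: "i \<in> {1..braid_dim S m \<alpha>}" "?c i = c"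
      by (elim imageE) simp
    show ?thesis
    proof (rule ex1I[of _ i])
      show "i \<in> {1..braid_dim S m \<alpha>} \<and> sig_entry S m i \<alpha> \<noteq> sig_entry S m i \<beta>"
        using i differ[OF i(1)] by simp
    next
      fix j assume j: "j \<in> {1..braid_dim S m \<alpha>} \<and> sig_entry S m j \<alpha> \<noteq> sig_entry S m j \<beta>"
      then have "?c j = ?c i" using differ[OF conjunct1[OF j]] i(2) by simp
      then show "j = i"
        using inj_onD[OF bij_betw_imp_inj_on[OF center_index_bij] _ conjunct1[OF j] i(1)] by blast
    qed
  qed
  show ?thesis
  proof (intro conjI unique ballI impI allI)
    fix i assume i: "i \<in> {1..braid_dim S m \<alpha>}" "sig_entry S m i \<alpha> \<noteq> sig_entry S m i \<beta>"
    have ci: "?c i = c" using differ[OF i(1)] i(2) by blast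
    have "sig_entry S m i w = w ! c" if "w \<in> K" for w
      using sig_entry_eq[OF that i(1)] unfolding ci .
    then have "sig_fiber S m i \<alpha> = {w \<in> K. w ! c = \<alpha> ! c}"
      using \<alpha> by (auto simp: sig_fiber_def)
    then show "semicube G \<alpha> \<beta> = sig_fiber S m i \<alpha>"
      unfolding \<beta> semicube_flip[OF \<alpha> c] by (rule HOL.sym)
    fix x y assume "{x, y} \<in> edges G"
    then obtain d where x: "x \<in> K" "active M d x" and y: "y = flip d x"
      using edge_iff_flip by blast
    show "{x, y} \<in> cut_edges G \<alpha> \<beta> \<longleftrightarrow> edge_labeled S m \<alpha> {x, y} i"
      unfolding \<beta> y cut_edge_flip_iff[OF \<alpha> c x] edge_labeled_flip_iff[OF i(1) x] ci by (rule HOL.refl)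
  qed
qed

end
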